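(* Let $\Gamma=(A_1,A_2,\mathbf{u})$ be a finite, player-symmetric, additively decomposable two-player normal-form game. Let $\mathrm{diff}$ be a policy difference function on pairs of threshold policies that is symmetric, high-value uninformative, and minimized by copies. If $(\pi_1,\pi_2)$ is a Nash equilibrium of the diff meta game $(\Gamma,\bar{\mathcal{A}}_1,\bar{\mathcal{A}}_2,\mathrm{diff})$ that is not Pareto-dominated by another Nash equilibrium of this meta game, then $V_1(\pi_1,\pi_2)=V_2(\pi_1,\pi_2)$. Hence, if there exists a Pareto-optimal Nash equilibrium of the meta game, its payoffs are unique, Pareto-dominant among Nash equilibria, and equal across the two players.
   Context: $\mathbf{u}=(u_1,u_2)\colon A_1\times A_2\to\mathbb{R}^2$ is extended to mixed strategies by expectation; $-i$ denotes the player other than $i$. $\Gamma$ is (player-)symmetric if $A_1=A_2$ and $u_i(a_1,a_2)=u_{-i}(a_2,a_1)$ for all $a_1,a_2$ and $i=1,2$. $\Gamma$ is additively decomposable if there are functions $u_{i,j}\colon A_j\to\mathbb{R}$ ($i,j\in\{1,2\}$) with $u_i(a_1,a_2)=u_{i,1}(a_1)+u_{i,2}(a_2)$ for all $i,a_1,a_2$. A threshold policy $(\sigma_i^{\leqslant},\theta,\sigma_i^{>})$ of Player $i$, with $\theta\in\mathbb{R}\cup\{-\infty,\infty\}$ and $\sigma_i^{\leqslant},\sigma_i^{>}\in\Delta(A_i)$, is the function $\pi\colon\mathbb{R}\to\Delta(A_i)$ with $\pi(d)=\sigma_i^{\leqslant}$ if $d\leq\theta$ and $\pi(d)=\sigma_i^{>}$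 otherwise. $\bar{\mathcal{A}}_i$ is the set of threshold policies of Player $i$ (in a symmetric game $\bar{\mathcal{A}}_1=\bar{\mathcal{A}}_2$). A policy difference function is a stochastic function $\mathrm{diff}=(\mathrm{diff}_1,\mathrm{diff}_2)$ assigning to each $(\pi_1,\pi_2)\in\bar{\mathcal{A}}_1\times\bar{\mathcal{A}}_2$ an $\mathbb{R}^2$-valued random variable. The pair $(\pi_1,\pi_2)$ plays $(\sigma_1,\sigma_2)$ if $\sigma_i=\mathbb{E}[\pi_i(\mathrm{diff}_i(\pi_1,\pi_2))]$ for $i=1,2$. The diff meta game $(\Gamma,\bar{\mathcal{A}}_1,\bar{\mathcal{A}}_2,\mathrm{diff})$ is the normal-form game with strategy sets $\bar{\mathcal{A}}_1,\bar{\mathcal{A}}_2$ and payoffs $V(\pi_1,\pi_2)=(V_1,V_2)(\pi_1,\pi_2)=\mathbb{E}\big[\mathbf{u}(\pi_1(\mathrm{diff}_1(\pi_1,\pi_2)),\pi_2(\mathrm{diff}_2(\pi_1,\pi_2)))\big]$. $\mathrm{diff}$ is minimized by copies if for all policies $\pi,\pi'$, all $y\in\mathbb{R}$ and $i=1,2$: $P(\mathrm{diff}_i(\pi,\pi')<y)\leq P(\mathrm{diff}_i(\pi,\pi)<y)$. $\mathrm{diff}$ is symmetric if for all $\pi_1,\pi_2$: $\mathrm{diff}(\pi_1,\pi_2)$ has the same distribution as $\mathrm{diff}(\pi_2,\pi_1)$, and $(\mathrm{diff}_1(\pi_1,\pi_2),\mathrm{diff}_2(\pi_1,\pi_2))$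 has the same distribution as $(\mathrm{diff}_2(\pi_1,\pi_2),\mathrm{diff}_1(\pi_1,\pi_2))$. For a threshold policy $\pi_{-i}=(\sigma_{-i}^{\leqslant},\theta_{-i},\sigma_{-i}^{>})$ let $p$ be the supremum of the numbers $p'\in[0,1]$ for which there is a policy $\pi_i\in\bar{\mathcal{A}}_i$ such that in $(\pi_i,\pi_{-i})$ Player $-i$ plays $(1-p')\sigma_{-i}^{\leqslant}+p'\sigma_{-i}^{>}$, and let $\sigma_{\pi_{-i}}^{\max}=(1-p)\sigma_{-i}^{\leqslant}+p\,\sigma_{-i}^{>}$. $\mathrm{diff}$ is high-value uninformative if for each $i\in\{1,2\}$, each threshold policy $\pi_{-i}$, each $\sigma_i\in\Delta(A_i)$ and each $\epsilon>0$ there is a threshold policy $\pi_i$ such that in $(\pi_i,\pi_{-i})$ a strategy profile within $\epsilon$ of $(\sigma_i,\sigma_{\pi_{-i}}^{\max})$ is played. A profile Pareto-dominates another if it gives both players at least as much payoff and at least one player strictly more; it is Pareto-optimal if no profile Pareto-dominates it. *)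

theory Defs
  imports "HOL-Probability.Probability"
begin

section \<open>Two-player games\<close>

datatype player = P1 | P2

instance player :: finite
proof
  have "(UNIV :: player set) \<subseteq> {P1, P2}"
    using player.exhaust by blast
  then show "finite (UNIV :: player set)"
    by (rule finite_subset) simp
qed

fun other :: "player \<Rightarrow> player" where
  "other P1 = P2"
| "other P2 = P1"

type_synonym 's profile = "player \<Rightarrow> 's"

definition pair :: "'s \<Rightarrow> 's \<Rightarrow> 's profile" where
  "pair x y = (\<lambda>i. case i of P1 \<Rightarrow> x | P2 \<Rightarrow> y)"

text \<open>In the profile \<open>against i x y\<close>, player \<open>i\<close> uses \<open>x\<close> and the opponent of \<open>i\<close> uses \<open>y\<close>.\<close>

definition against :: "player \<Rightarrow> 's \<Rightarrow> 's \<Rightarrow> 's profile" where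
  "against i x y = (\<lambda>j. if j = i then x else y)"

record 's game =
  strategies :: "player \<Rightarrow> 's set"
  payoff :: "'s profile \<Rightarrow> player \<Rightarrow> real"

definition profiles :: "'s game \<Rightarrow> 's profile set" where
  "profiles G = {s. \<forall>i. s i \<in> strategies G i}"

definition nash_equilibrium :: "'s game \<Rightarrow> 's profile \<Rightarrow> bool" where
  "nash_equilibrium G s \<longleftrightarrow> s \<in> profiles G \<and>
     (\<forall>i. \<forall>x \<in> strategies G i. payoff G (s(i := x)) i \<le> payoff G s i)"

definition pareto_dominates :: "'s game \<Rightarrow> 's profile \<Rightarrow> 's profile \<Rightarrow> bool" where
  "pareto_dominates G s t \<longleftrightarrow>
     (\<forall>i. payoff G t i \<le> payoff G s i) \<and> (\<exists>i. payoff G t i < payoff G s i)"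

definition pareto_optimal :: "'s game \<Rightarrow> 's profile \<Rightarrow> bool" where
  "pareto_optimal G s \<longleftrightarrow> s \<in> profiles G \<and> \<not> (\<exists>t \<in> profiles G. pareto_dominates G t s)"


section \<open>The finite base game\<close>

text \<open>
  The finite, nonempty action set shared by both players is the type \<open>'a :: finite\<close>, so the
  requirement that the action sets of a symmetric game coincide is built into the types. The base
  game is then given by its payoff function alone. A mixed strategy is a point of the probability
  simplex in \<open>real ^ 'a\<close>, so that expected strategies, convex combinations and distances
  are those of this Euclidean space.
\<close>

type_synonym 'a base_game = "'a profile \<Rightarrow> player \<Rightarrow> real"

definition symmetric_game :: "'a base_game \<Rightarrow> bool" where
  "symmetric_game u \<longleftrightarrow> (\<forall>i a1 a2. u (pair a1 a2) i = u (pair a2 a1) (other i))"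

definition additively_decomposable :: "'a base_game \<Rightarrow> bool" where
  "additively_decomposable u \<longleftrightarrow>
     (\<exists>w :: player \<Rightarrow> player \<Rightarrow> 'a \<Rightarrow> real.
        \<forall>i a1 a2. u (pair a1 a2) i = w i P1 a1 + w i P2 a2)"

definition mixed_strategies :: "(real ^ 'a::finite) set" where
  "mixed_strategies = {\<sigma>. (\<forall>a. 0 \<le> \<sigma> $ a) \<and> (\<Sum>a\<in>UNIV. \<sigma> $ a) = 1}"

definition mixed_payoff :: "'a::finite base_game \<Rightarrow> (real ^ 'a) profile \<Rightarrow> player \<Rightarrow> real" where
  "mixed_payoff u \<sigma> i =
     (\<Sum>a1\<in>UNIV. \<Sum>a2\<in>UNIV. \<sigma> P1 $ a1 * \<sigma> P2 $ a2 * u (pair a1 a2) i)"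


section \<open>Threshold policies and policy difference functions\<close>

type_synonym 'a policy = "real \<Rightarrow> real ^ 'a"

definition threshold_policy :: "real ^ 'a \<Rightarrow> ereal \<Rightarrow> real ^ 'a \<Rightarrow> 'a::finite policy" where
  "threshold_policy \<sigma>le \<theta> \<sigma>gt = (\<lambda>d. if ereal d \<le> \<theta> then \<sigma>le else \<sigma>gt)"

definition threshold_policies :: "'a::finite policy set" where
  "threshold_policies =
     {threshold_policy \<sigma>le \<theta> \<sigma>gt | \<sigma>le \<theta> \<sigma>gt.
        \<sigma>le \<in> mixed_strategies \<and> \<sigma>gt \<in> mixed_strategies}"

text \<open>
  Only the law of the random vector assigned to each pair of policies matters, so a stochastic
  function is a map into probability measures on the Borel sets of \<open>real ^ player\<close>. Values
  outside pairs of threshold policies are irrelevant and left unconstrained.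
\<close>

type_synonym 'a diff = "'a policy profile \<Rightarrow> (real ^ player) measure"

definition policy_difference :: "'a::finite diff \<Rightarrow> bool" where
  "policy_difference D \<longleftrightarrow>
     (\<forall>\<pi>1 \<in> threshold_policies. \<forall>\<pi>2 \<in> threshold_policies.
        prob_space (D (pair \<pi>1 \<pi>2)) \<and> sets (D (pair \<pi>1 \<pi>2)) = sets borel)"

definition played :: "'a::finite diff \<Rightarrow> 'a policy profile \<Rightarrow> (real ^ 'a) profile" where
  "played D \<pi> i = (\<integral>d. \<pi> i (d $ i) \<partial>D \<pi>)"

definition diff_meta_game :: "'a::finite base_game \<Rightarrow> 'a diff \<Rightarrow> 'a policy game" where
  "diff_meta_game u D =
     \<lparr> strategies = (\<lambda>i. threshold_policies),
       payoff = (\<lambda>\<pi> i. \<integral>d. mixed_payoff u (\<lambda>j. \<pi> j (d $ j)) i \<partial>D \<pi>) \<rparr>"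

definition minimized_by_copies :: "'a::finite diff \<Rightarrow> bool" where
  "minimized_by_copies D \<longleftrightarrow>
     (\<forall>\<pi> \<in> threshold_policies. \<forall>\<pi>' \<in> threshold_policies. \<forall>y i.
        measure (D (pair \<pi> \<pi>')) {d. d $ i < y} \<le> measure (D (pair \<pi> \<pi>)) {d. d $ i < y})"

definition symmetric_diff :: "'a::finite diff \<Rightarrow> bool" where
  "symmetric_diff D \<longleftrightarrow>
     (\<forall>\<pi>1 \<in> threshold_policies. \<forall>\<pi>2 \<in> threshold_policies.
        D (pair \<pi>1 \<pi>2) = D (pair \<pi>2 \<pi>1) \<and>
        D (pair \<pi>1 \<pi>2) = distr (D (pair \<pi>1 \<pi>2)) borel (\<lambda>d. \<chi> i. d $ other i))"

text \<open>
  Here the opponent of player \<open>i\<close> holds the threshold policy with parameters \<open>\<sigma>le\<close>, \<open>\<theta>\<close>,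
  \<open>\<sigma>gt\<close>, while \<open>i\<close> chooses the policy faced by it. The parameters are passed rather than the
  policy as a function, because constant policies have several parametrisations.
\<close>

definition max_prob ::
    "'a::finite diff \<Rightarrow> player \<Rightarrow> real ^ 'a \<Rightarrow> ereal \<Rightarrow> real ^ 'a \<Rightarrow> real" where
  "max_prob D i \<sigma>le \<theta> \<sigma>gt =
     Sup {p \<in> {0..1}. \<exists>\<pi> \<in> threshold_policies.
            played D (against i \<pi> (threshold_policy \<sigma>le \<theta> \<sigma>gt)) (other i)
              = (1 - p) *\<^sub>R \<sigma>le + p *\<^sub>R \<sigma>gt}"

definition max_strategy ::
    "'a::finite diff \<Rightarrow> player \<Rightarrow> real ^ 'a \<Rightarrow> ereal \<Rightarrow> real ^ 'a \<Rightarrow> real ^ 'a" where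
  "max_strategy D i \<sigma>le \<theta> \<sigma>gt =
     (1 - max_prob D i \<sigma>le \<theta> \<sigma>gt) *\<^sub>R \<sigma>le + max_prob D i \<sigma>le \<theta> \<sigma>gt *\<^sub>R \<sigma>gt"

definition high_value_uninformative :: "'a::finite diff \<Rightarrow> bool" where
  "high_value_uninformative D \<longleftrightarrow>
     (\<forall>i. \<forall>\<sigma>le \<in> mixed_strategies. \<forall>\<theta>. \<forall>\<sigma>gt \<in> mixed_strategies.
        \<forall>\<sigma> \<in> mixed_strategies. \<forall>\<epsilon>>0. \<exists>\<pi> \<in> threshold_policies.
          dist (played D (against i \<pi> (threshold_policy \<sigma>le \<theta> \<sigma>gt)) i) \<sigma> < \<epsilon> \<and>
          dist (played D (against i \<pi> (threshold_policy \<sigma>le \<theta> \<sigma>gt)) (other i))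
               (max_strategy D i \<sigma>le \<theta> \<sigma>gt) < \<epsilon>)"

end

theory Submission
  imports Defs
begin

text \<open>
  Symmetry and additivity give \<open>u\<^sub>i = f(a\<^sub>i) + g(a\<^sub>-\<^sub>i)\<close> with the same \<open>f\<close> and \<open>g\<close> for both players;
  let \<open>h = f + g\<close>. Let a Nash equilibrium with payoffs \<open>V\<close> play \<open>\<sigma>\<close>. Player \<open>i\<close> could copy the
  opponent's policy, so \<open>V\<^sub>i\<close> is at least \<open>h(\<tau>)\<close>, where \<open>\<tau>\<close> is played by that policy against its
  copy; and player \<open>i\<close> could optimize \<open>f\<close> against \<open>\<sigma>\<^sup>m\<^sup>a\<^sup>x\<close>, so \<open>V\<^sub>i\<close> is at least
  \<open>max f + g(\<sigma>\<^sup>m\<^sup>a\<^sup>x) \<ge> h(\<sigma>\<^sup>m\<^sup>a\<^sup>x)\<close>. Since \<open>\<sigma>\<^sub>-\<^sub>i\<close> lies between \<open>\<tau>\<close> and \<open>\<sigma>\<^sup>m\<^sup>a\<^sup>x\<close>, this yields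
  \<open>h(\<sigma>\<^sub>-\<^sub>i) \<le> V\<^sub>i\<close>. Both sides have the same sum over \<open>i\<close>, so equality holds. Hence either
  \<open>h(\<tau>) = V\<^sub>i\<close>, and both players using the opponent's policy is an equilibrium, or
  \<open>\<sigma>\<^sub>-\<^sub>i\<close> maximizes \<open>f\<close>, and both players using the constant policy \<open>\<sigma>\<^sub>-\<^sub>i\<close> is one. Either way
  there is an equilibrium paying \<open>V\<^sub>i\<close> to both players.
\<close>

section \<open>Profiles and mixed strategies\<close>

lemma other_other [simp]: "other (other i) = i"
  by (cases i) auto

lemma all_player_iff: "(\<forall>j. P j) \<longleftrightarrow> P i \<and> P (other i)"
  by (cases i) (metis other.simps player.exhaust)+

lemma pair_eta: "pair (\<rho> P1) (\<rho> P2) = \<rho>"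
  by (auto simp: pair_def fun_eq_iff split: player.splits)

lemma pair_other: "pair x y (other i) = pair y x i"
  by (cases i) (auto simp: pair_def)

lemma pair_same: "pair x x = (\<lambda>_. x)"
  by (auto simp: pair_def fun_eq_iff split: player.splits)

lemma pair_component: "pair x y P1 = x" "pair x y P2 = y"
  by (simp_all add: pair_def)

text \<open>Uninformativeness is phrased with \<open>against\<close>, equilibrium deviations with
  function update; this translates between the two.\<close>

lemma against_other: "against i x (\<rho> (other i)) = \<rho>(i := x)"
proof
  fix j
  have "j = other i" if "j \<noteq> i"
    using that by (cases i; cases j) auto
  then show "against i x (\<rho> (other i)) j = (\<rho>(i := x)) j"
    by (auto simp: against_def)
qed

lemma mixed_strategies_convex:
  assumes "\<sigma> \<in> mixed_strategies" "\<tau> \<in> mixed_strategies" "0 \<le> p" "p \<le> 1"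
  shows "(1 - p) *\<^sub>R \<sigma> + p *\<^sub>R \<tau> \<in> mixed_strategies"
  using assms
  by (auto simp: mixed_strategies_def sum.distrib simp flip: sum_distrib_left)

text \<open>In each summand one player's probabilities factor out and add up to 1, so expected
  payoffs are linear in each player's strategy.\<close>

lemma mixed_payoff_additive:
  assumes u: "\<And>a b. u (pair a b) i = v a + w b"
    and \<sigma>: "\<sigma> P1 \<in> mixed_strategies" "\<sigma> P2 \<in> mixed_strategies"
  shows "mixed_payoff u \<sigma> i = (\<chi> a. v a) \<bullet> \<sigma> P1 + (\<chi> a. w a) \<bullet> \<sigma> P2"
proof -
  have s: "(\<Sum>a\<in>UNIV. \<sigma> P1 $ a) = 1" "(\<Sum>a\<in>UNIV. \<sigma> P2 $ a) = 1"
    using \<sigma> by (auto simp: mixed_strategies_def)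
  have "mixed_payoff u \<sigma> i =
      (\<Sum>a\<in>UNIV. \<Sum>b\<in>UNIV. (v a * \<sigma> P1 $ a) * \<sigma> P2 $ b + \<sigma> P1 $ a * (w b * \<sigma> P2 $ b))"
    unfolding mixed_payoff_def u by (simp add: algebra_simps)
  also have "\<dots> = (\<Sum>a\<in>UNIV. v a * \<sigma> P1 $ a) * (\<Sum>b\<in>UNIV. \<sigma> P2 $ b)
      + (\<Sum>a\<in>UNIV. \<sigma> P1 $ a) * (\<Sum>b\<in>UNIV. w b * \<sigma> P2 $ b)"
    by (simp add: sum.distrib sum_product)
  finally show ?thesis
    by (simp add: s inner_vec_def)
qed

lemma threshold_policyE:
  assumes "\<pi> \<in> threshold_policies"
  obtains a \<theta> b where "\<pi> = threshold_policy a \<theta> b" "a \<in> mixed_strategies" "b \<in> mixed_strategies"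
  using assms unfolding threshold_policies_def by blast

lemma threshold_policy_mixed:
  assumes "\<pi> \<in> threshold_policies"
  shows "\<pi> d \<in> mixed_strategies"
  using assms by (elim threshold_policyE) (auto simp: threshold_policy_def)

lemma constant_policy:
  assumes "\<sigma> \<in> mixed_strategies"
  shows "(\<lambda>_. \<sigma>) \<in> threshold_policies"
proof -
  have "(\<lambda>_. \<sigma>) = threshold_policy \<sigma> 0 \<sigma>"
    by (simp add: threshold_policy_def)
  then show ?thesis
    using assms unfolding threshold_policies_def by blast
qed

text \<open>Player-symmetry and additivity are condensed into the assumption \<open>u\<close>: the
  same \<open>f\<close> rates the own action and the same \<open>g\<close> the opponent's, for both
  players. Taking them as vectors turns expected payoffs into inner products.\<close>

locale symmetric_meta_game =
  fixes u :: "'a::finite base_game" and D :: "'a diff" and f g :: "real ^ 'a"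
  assumes u: "u (pair a1 a2) i = f $ pair a1 a2 i + g $ pair a1 a2 (other i)"
    and policy_difference: "policy_difference D"
    and symmetric: "symmetric_diff D"
    and uninformative: "high_value_uninformative D"
    and minimized: "minimized_by_copies D"
begin

abbreviation policies :: "'a policy profile \<Rightarrow> bool" where
  "policies \<rho> \<equiv> (\<forall>i. \<rho> i \<in> threshold_policies)"

abbreviation V :: "'a policy profile \<Rightarrow> player \<Rightarrow> real" where
  "V \<equiv> payoff (diff_meta_game u D)"

abbreviation nash :: "'a policy profile \<Rightarrow> bool" where
  "nash \<equiv> nash_equilibrium (diff_meta_game u D)"

section \<open>Symmetry and measurability of the difference laws\<close>

lemma diff_prob_space:
  assumes "policies \<rho>"
  shows "prob_space (D \<rho>)" "sets (D \<rho>) = sets borel"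
  using policy_difference assms pair_eta[of \<rho>] unfolding policy_difference_def by metis+

lemma diff_swap_players:
  assumes "policies \<rho>"
  shows "D (\<lambda>i. \<rho> (other i)) = D \<rho>"
proof -
  have "(\<lambda>i. \<rho> (other i)) = pair (\<rho> P2) (\<rho> P1)"
    using pair_other[of "\<rho> P1" "\<rho> P2"] by (simp add: pair_eta)
  then show ?thesis
    using symmetric assms pair_eta[of \<rho>] unfolding symmetric_diff_def by metis
qed

lemma diff_swap_values:
  assumes "policies \<rho>"
  shows "distr (D \<rho>) borel (\<lambda>d. \<chi> i. d $ other i) = D \<rho>"
  using symmetric assms pair_eta[of \<rho>] unfolding symmetric_diff_def by metis

lemma measurable_swap [measurable]:
  "(\<lambda>d :: real ^ player. \<chi> i. d $ other i) \<in> borel_measurable borel"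
  by (intro borel_measurable_continuous_onI continuous_intros)

lemma measurable_component:
  assumes "policies \<rho>"
  shows "(\<lambda>d. d $ i) \<in> borel_measurable (D \<rho>)"
  by (subst measurable_cong_sets[OF diff_prob_space(2)[OF assms] refl])
    (intro borel_measurable_continuous_onI continuous_intros)

lemma diff_swap_integral:
  fixes F :: "real ^ player \<Rightarrow> 'b::{banach, second_countable_topology}"
  assumes "policies \<rho>" and F: "F \<in> borel_measurable borel"
  shows "(\<integral>d. F (\<chi> i. d $ other i) \<partial>D \<rho>) = (\<integral>d. F d \<partial>D \<rho>)"
proof -
  have "(\<lambda>d :: real ^ player. \<chi> i. d $ other i) \<in> measurable (D \<rho>) borel"
    by (subst measurable_cong_sets[OF diff_prob_space(2)[OF assms(1)] refl])
      (rule measurable_swap)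
  then show ?thesis
    using integral_distr[OF _ F] diff_swap_values[OF assms(1)] by metis
qed

section \<open>Played strategies and payoffs\<close>

lemma measurable_policy:
  assumes "\<pi> \<in> threshold_policies"
  shows "\<pi> \<in> borel_measurable borel"
  using assms by (elim threshold_policyE) (simp add: threshold_policy_def)

lemma integrable_policy:
  assumes "policies \<rho>"
  shows "integrable (D \<rho>) (\<lambda>d. \<rho> i (d $ i))"
proof -
  interpret prob_space "D \<rho>"
    by (rule diff_prob_space[OF assms])
  obtain a \<theta> b where \<rho>: "\<rho> i = threshold_policy a \<theta> b"
    using assms threshold_policyE by metis
  have "(\<lambda>d. \<rho> i (d $ i)) \<in> borel_measurable (D \<rho>)"
    using measurable_compose[OF measurable_component[OF assms] measurable_policy] assms by blast
  then show ?thesis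
    by (intro integrable_const_bound[where B = "max (norm a) (norm b)"])
      (auto simp: \<rho> threshold_policy_def)
qed

text \<open>A threshold policy takes only two values, so its mean is fixed by the probability
  \<open>p\<close> of exceeding the threshold.\<close>

lemma played_threshold:
  assumes "policies \<rho>" and \<rho>: "\<rho> i = threshold_policy a \<theta> b"
  defines "p \<equiv> 1 - measure (D \<rho>) {d. ereal (d $ i) \<le> \<theta>}"
  shows "played D \<rho> i = (1 - p) *\<^sub>R a + p *\<^sub>R b" "0 \<le> p" "p \<le> 1"
proof -
  interpret prob_space "D \<rho>"
    by (rule diff_prob_space[OF assms(1)])
  let ?A = "{d. ereal (d $ i) \<le> \<theta>}"
  have sp: "space (D \<rho>) = UNIV"
    using sets_eq_imp_space_eq[OF diff_prob_space(2)[OF assms(1)]] by simp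
  have m [measurable]: "(\<lambda>d. d $ i) \<in> borel_measurable (D \<rho>)"
    by (rule measurable_component[OF assms(1)])
  have "{d \<in> space (D \<rho>). ereal (d $ i) \<le> \<theta>} \<in> sets (D \<rho>)"
    by measurable
  then have A: "?A \<in> sets (D \<rho>)"
    by (simp add: sp)
  have "played D \<rho> i = (\<integral>d. b + indicator ?A d *\<^sub>R (a - b) \<partial>D \<rho>)"
    unfolding played_def \<rho> threshold_policy_def
    by (intro Bochner_Integration.integral_cong) (auto simp: indicator_def)
  also have "\<dots> = b + measure (D \<rho>) ?A *\<^sub>R (a - b)"
    using A by (subst Bochner_Integration.integral_add) (auto simp: prob_space less_top[symmetric])
  finally show "played D \<rho> i = (1 - p) *\<^sub>R a + p *\<^sub>R b"
    by (simp add: p_def algebra_simps)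
  show "0 \<le> p" "p \<le> 1"
    by (auto simp: p_def)
qed

lemma played_mixed:
  assumes "policies \<rho>"
  shows "played D \<rho> i \<in> mixed_strategies"
proof -
  obtain a \<theta> b where "\<rho> i = threshold_policy a \<theta> b" "a \<in> mixed_strategies" "b \<in> mixed_strategies"
    using assms threshold_policyE by metis
  then show ?thesis
    using played_threshold[OF assms] mixed_strategies_convex by metis
qed

text \<open>Neither exchanging the policies nor exchanging the coordinates changes the law; doing
  both exchanges the roles of the players.\<close>

lemma played_swap:
  assumes "policies \<rho>"
  shows "played D (\<lambda>i. \<rho> (other i)) i = played D \<rho> (other i)"
proof -
  have "(\<lambda>d. \<rho> (other i) (d $ other i)) \<in> borel_measurable borel"
    using assms
    by (intro measurable_compose[OF _ measurable_policy]) (auto intro!: borel_measurable_continuous_onI continuous_intros)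
  from diff_swap_integral[OF assms this] show ?thesis
    by (simp add: played_def diff_swap_players[OF assms])
qed

text \<open>The two differences may be correlated, but an additive payoff has no cross term, so its
  mean depends only on the two played strategies.\<close>

lemma payoff_eq:
  assumes "policies \<rho>"
  shows "V \<rho> i = f \<bullet> played D \<rho> i + g \<bullet> played D \<rho> (other i)"
proof -
  have mixed: "\<rho> j t \<in> mixed_strategies" for j t
    using threshold_policy_mixed assms by blast
  have mp: "mixed_payoff u (\<lambda>j. \<rho> j (d $ j)) i
      = f \<bullet> \<rho> i (d $ i) + g \<bullet> \<rho> (other i) (d $ other i)" for d :: "real ^ player"
  proof (cases i)
    case P1
    have "u (pair a b) P1 = f $ a + g $ b" for a b
      by (simp add: u pair_component)
    from mixed_payoff_additive[of u P1, OF this, of "\<lambda>j. \<rho> j (d $ j)"] show ?thesis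
      using P1 mixed by (simp add: add.commute)
  next
    case P2
    have "u (pair a b) P2 = g $ a + f $ b" for a b
      by (simp add: u pair_component)
    from mixed_payoff_additive[of u P2, OF this, of "\<lambda>j. \<rho> j (d $ j)"] show ?thesis
      using P2 mixed by (simp add: add.commute)
  qed
  show ?thesis
    using integrable_policy[OF assms] by (simp add: diff_meta_game_def mp played_def)
qed

lemma payoff_swap:
  assumes "policies \<rho>"
  shows "V (\<lambda>i. \<rho> (other i)) i = V \<rho> (other i)"
proof -
  have "policies (\<lambda>i. \<rho> (other i))"
    using assms by blast
  then show ?thesis
    using assms by (simp add: payoff_eq played_swap)
qed

lemma nash_iff:
  "nash \<rho> \<longleftrightarrow> policies \<rho> \<and> (\<forall>i. \<forall>x\<in>threshold_policies. V (\<rho>(i := x)) i \<le> V \<rho> i)"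
  by (simp add: nash_equilibrium_def diff_meta_game_def profiles_def)

section \<open>Play against a copy\<close>

lemma played_copies:
  assumes "\<pi> \<in> threshold_policies"
  shows "played D (\<lambda>_. \<pi>) i = played D (\<lambda>_. \<pi>) j"
proof -
  have "played D (\<lambda>_. \<pi>) i = played D (\<lambda>_. \<pi>) (other i)" for i
    using played_swap[of "\<lambda>_. \<pi>"] assms by simp
  from this[of P1] show ?thesis
    by (cases i; cases j) simp_all
qed

text \<open>The hypothesis only compares with copies of the first policy; invariance of the law
  under exchanging policies covers the second.\<close>

lemma measure_less_copies:
  assumes "policies \<rho>"
  shows "measure (D \<rho>) {d. d $ i < y} \<le> measure (D (\<lambda>_. \<rho> j)) {d. d $ i < y}"
proof -
  have *: "measure (D (pair x x')) {d. d $ i < y} \<le> measure (D (\<lambda>_. x)) {d. d $ i < y}"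
    if "x \<in> threshold_policies" "x' \<in> threshold_policies" for x x'
    using minimized that unfolding minimized_by_copies_def pair_same[symmetric] by blast
  have "D (pair (\<rho> P1) (\<rho> P2)) = D (pair (\<rho> P2) (\<rho> P1))"
    using symmetric assms unfolding symmetric_diff_def by blast
  then show ?thesis
    using *[of "\<rho> P1" "\<rho> P2"] *[of "\<rho> P2" "\<rho> P1"] assms by (cases j) (simp_all add: pair_eta)
qed

text \<open>Minimization by copies concerns strict inequalities while policies test
  \<open>d \<le> \<theta>\<close>; continuity from above bridges the gap.\<close>

lemma measure_le_threshold_LIMSEQ:
  assumes "policies \<rho>"
  shows "(\<lambda>n. measure (D \<rho>) {d. d $ i < \<theta> + 1 / Suc n}) \<longlonglongrightarrow> measure (D \<rho>) {d. d $ i \<le> \<theta>}"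
proof -
  interpret prob_space "D \<rho>"
    by (rule diff_prob_space[OF assms])
  have "(\<Inter>n. {d. d $ i < \<theta> + 1 / Suc n}) = {d :: real ^ player. d $ i \<le> \<theta>}"
  proof (intro equalityI subsetI INT_I)
    fix d :: "real ^ player"
    assume d: "d \<in> (\<Inter>n. {d. d $ i < \<theta> + 1 / Suc n})"
    have "(\<lambda>n. \<theta> + 1 / Suc n) \<longlonglongrightarrow> \<theta> + 0"
      by (intro tendsto_add tendsto_const LIMSEQ_Suc[OF lim_1_over_n])
    moreover have "d $ i \<le> \<theta> + 1 / Suc n" for n
      using d by (intro less_imp_le) blast
    ultimately have "d $ i \<le> \<theta> + 0"
      by (intro LIMSEQ_le_const) auto
    then show "d \<in> {d. d $ i \<le> \<theta>}"
      by simp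
  next
    show "d \<in> {d. d $ i < \<theta> + 1 / Suc n}" if "d \<in> {d. d $ i \<le> \<theta>}" for n and d :: "real ^ player"
      using that add_le_less_mono[of "d $ i" \<theta> 0 "1 / real (Suc n)"] by simp
  qed
  moreover have "{d. d $ i < y} \<in> sets (D \<rho>)" for y
  proof -
    have "open {d :: real ^ player. d $ i < y}"
      by (intro open_Collect_less continuous_intros)
    then show ?thesis
      by (simp add: diff_prob_space[OF assms])
  qed
  moreover have "decseq (\<lambda>n. {d :: real ^ player. d $ i < \<theta> + 1 / Suc n})"
  proof (intro antimonoI Collect_mono impI)
    fix m n :: nat and d :: "real ^ player"
    assume "m \<le> n" "d $ i < \<theta> + 1 / Suc n"
    moreover from \<open>m \<le> n\<close> have "1 / real (Suc n) \<le> 1 / real (Suc m)"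
      by (intro divide_left_mono) auto
    ultimately show "d $ i < \<theta> + 1 / Suc m"
      by linarith
  qed
  ultimately show ?thesis
    using finite_Lim_measure_decseq[of "\<lambda>n. {d. d $ i < \<theta> + 1 / Suc n}"] by (simp add: image_subset_iff)
qed

text \<open>Finite thresholds follow by passing to the limit. At an infinite threshold both events
  are certain or both are empty.\<close>

lemma measure_le_copies:
  assumes "policies \<rho>"
  shows "measure (D \<rho>) {d. ereal (d $ i) \<le> \<theta>} \<le> measure (D (\<lambda>_. \<rho> j)) {d. ereal (d $ i) \<le> \<theta>}"
proof (cases \<theta>)
  case (real r)
  have "policies (\<lambda>_. \<rho> j)"
    using assms by blast
  from LIMSEQ_le[OF measure_le_threshold_LIMSEQ[OF assms] measure_le_threshold_LIMSEQ[OF this]]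
  show ?thesis
    using measure_less_copies[OF assms] real by auto
next
  case PInf
  have "prob_space (D \<rho>')" "space (D \<rho>') = UNIV" if "policies \<rho>'" for \<rho>'
    using diff_prob_space[OF that] sets_eq_imp_space_eq by fastforce+
  then have "measure (D \<rho>') UNIV = 1" if "policies \<rho>'" for \<rho>'
    using that prob_space.prob_space by metis
  then show ?thesis
    using PInf assms by simp
qed simp

section \<open>Bounds on equilibrium payoffs\<close>

text \<open>Uninformativeness supplies deviations whose play comes arbitrarily close to
  \<open>\<sigma>\<close> and \<open>max_strategy\<close>, and payoffs are continuous in what is
  played.\<close>

lemma payoff_max_response:
  assumes \<rho>: "nash \<rho>" and j: "\<rho> (other i) = threshold_policy a \<theta> b"
    and ab: "a \<in> mixed_strategies" "b \<in> mixed_strategies"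
    and \<sigma>: "\<sigma> \<in> mixed_strategies"
  shows "f \<bullet> \<sigma> + g \<bullet> max_strategy D i a \<theta> b \<le> V \<rho> i"
proof (rule ccontr)
  let ?m = "max_strategy D i a \<theta> b"
  assume contra: "\<not> ?thesis"
  define \<delta> where "\<delta> = f \<bullet> \<sigma> + g \<bullet> ?m - V \<rho> i"
  \<comment> \<open>Chosen so that the approximation loss
    \<open>(norm f + norm g) * \<epsilon>\<close> stays below the supposed gain
    \<open>\<delta>\<close>; the summand 1 excludes division by zero.\<close>
  define \<epsilon> where "\<epsilon> = \<delta> / (norm f + norm g + 1)"
  have \<delta>: "\<delta> > 0"
    using contra by (simp add: \<delta>_def)
  have K: "norm f + norm g + 1 > 0"
    using norm_ge_zero[of f] norm_ge_zero[of g] by linarith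
  have \<epsilon>: "\<epsilon> > 0"
    using \<delta> K by (simp add: \<epsilon>_def)
  obtain x where x: "x \<in> threshold_policies"
    and d: "dist (played D (\<rho>(i := x)) i) \<sigma> < \<epsilon>" "dist (played D (\<rho>(i := x)) (other i)) ?m < \<epsilon>"
    using uninformative ab \<sigma> \<epsilon> unfolding high_value_uninformative_def
    by (metis j against_other)
  have near: "k \<bullet> \<tau> - norm k * \<epsilon> \<le> k \<bullet> \<tau>'" if "dist \<tau>' \<tau> < \<epsilon>" for k \<tau> \<tau>' :: "real ^ 'a"
  proof -
    have "k \<bullet> (\<tau> - \<tau>') \<le> norm k * norm (\<tau> - \<tau>')"
      by (rule norm_cauchy_schwarz)
    also have "\<dots> \<le> norm k * \<epsilon>"
      using that by (intro mult_left_mono) (auto simp: dist_norm norm_minus_commute)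
    finally show ?thesis
      by (simp add: inner_diff_right)
  qed
  have "policies (\<rho>(i := x))"
    using \<rho> x by (simp add: nash_iff)
  then have "f \<bullet> \<sigma> - norm f * \<epsilon> + (g \<bullet> ?m - norm g * \<epsilon>) \<le> V (\<rho>(i := x)) i"
    unfolding payoff_eq[OF \<open>policies (\<rho>(i := x))\<close>] by (intro add_mono near d)
  also have "\<dots> \<le> V \<rho> i"
    using \<rho> x by (simp add: nash_iff)
  finally have "\<delta> \<le> (norm f + norm g) * \<epsilon>"
    by (simp add: \<delta>_def algebra_simps)
  also have "\<dots> < (norm f + norm g + 1) * \<epsilon>"
    using \<epsilon> by (simp add: algebra_simps)
  also have "\<dots> = \<delta>"
    using K by (simp add: \<epsilon>_def)
  finally show False
    by simp
qed

text \<open>All relevant strategies of the opponent lie on the segment from \<open>a\<close> to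
  \<open>b\<close>, on which \<open>f + g\<close> is affine: a bound at two points carries over to
  any point between them, and equality there forces equality at an endpoint.\<close>

lemma nash_opponent_strategy:
  fixes i
  assumes \<rho>: "nash \<rho>"
  defines "\<sigma> \<equiv> played D \<rho> (other i)"
  shows "(f + g) \<bullet> \<sigma> \<le> V \<rho> i"
    and "(f + g) \<bullet> \<sigma> = V \<rho> i \<Longrightarrow>
      V (\<lambda>_. \<rho> (other i)) i = V \<rho> i \<or> (\<forall>\<tau>\<in>mixed_strategies. f \<bullet> \<tau> \<le> f \<bullet> \<sigma>)"
proof -
  let ?j = "other i" and ?C = "\<lambda>_ :: player. \<rho> (other i)" and ?h = "f + g"
  have pol: "policies \<rho>" and polC: "policies ?C"
    using \<rho> by (auto simp: nash_iff)
  obtain a \<theta> b where j: "\<rho> ?j = threshold_policy a \<theta> b"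
    and ab: "a \<in> mixed_strategies" "b \<in> mixed_strategies"
    using pol threshold_policyE by metis
  define L where "L s = ?h \<bullet> ((1 - s) *\<^sub>R a + s *\<^sub>R b)" for s
  have L: "L s = (1 - s) * (?h \<bullet> a) + s * (?h \<bullet> b)" for s
    by (simp add: L_def inner_add_right)
  \<comment> \<open>Weights that the opponent's policy puts on \<open>b\<close>: in the equilibrium,
    against its own copy, and at the supremum defining \<open>max_strategy\<close>.\<close>
  define p q r where "p = 1 - measure (D \<rho>) {d. ereal (d $ ?j) \<le> \<theta>}"
    and "q = 1 - measure (D ?C) {d. ereal (d $ ?j) \<le> \<theta>}"
    and "r = max_prob D i a \<theta> b"
  have \<sigma>: "\<sigma> = (1 - p) *\<^sub>R a + p *\<^sub>R b" and p: "0 \<le> p" "p \<le> 1"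
    using played_threshold[OF pol j] by (auto simp: p_def \<sigma>_def)
  have "V ?C i = ?h \<bullet> played D ?C ?j"
    using payoff_eq[OF polC, of i] played_copies[of "\<rho> ?j" i ?j] pol by (simp add: inner_add_left)
  then have Lq: "L q = V ?C i"
    using played_threshold[OF polC j] by (simp add: L_def q_def)
  have "V (\<rho>(i := \<rho> ?j)) i \<le> V \<rho> i"
    using \<rho> by (simp add: nash_iff)
  moreover have "\<rho>(i := \<rho> ?j) = ?C"
    using all_player_iff[of "\<lambda>k. (\<rho>(i := \<rho> ?j)) k = \<rho> ?j" i] by auto
  ultimately have Lq_le: "L q \<le> V \<rho> i"
    by (simp add: Lq)
  \<comment> \<open>Copies make small differences most likely, so facing its copy the policy plays
    \<open>a\<close> most.\<close>
  have "q \<le> p"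
    using measure_le_copies[OF pol, of ?j \<theta> ?j] by (simp add: p_def q_def)
  have "against i (\<rho> i) (threshold_policy a \<theta> b) = \<rho>"
    using against_other[of i "\<rho> i" \<rho>] by (simp add: j)
  then have "\<exists>\<pi>\<in>threshold_policies.
      played D (against i \<pi> (threshold_policy a \<theta> b)) ?j = (1 - p) *\<^sub>R a + p *\<^sub>R b"
    using pol \<sigma> unfolding \<sigma>_def by metis
  \<comment> \<open>The equilibrium policy of \<open>i\<close> itself witnesses that weight
    \<open>p\<close> is attainable.\<close>
  then have mem: "p \<in> {p \<in> {0..1}. \<exists>\<pi>\<in>threshold_policies.
      played D (against i \<pi> (threshold_policy a \<theta> b)) ?j = (1 - p) *\<^sub>R a + p *\<^sub>R b}"
    using p by simp
  have "p \<le> r"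
    unfolding r_def max_prob_def
    by (rule cSup_upper[OF mem]) (auto intro!: bdd_aboveI[where M = 1])
  have r1: "r \<le> 1"
    unfolding r_def max_prob_def using mem by (intro cSup_least) auto
  let ?m = "(1 - r) *\<^sub>R a + r *\<^sub>R b"
  have response: "f \<bullet> \<tau> + g \<bullet> ?m \<le> V \<rho> i" if "\<tau> \<in> mixed_strategies" for \<tau>
    using payoff_max_response[OF \<rho> j ab that] by (simp add: max_strategy_def r_def)
  have "?m \<in> mixed_strategies"
    using ab p r1 \<open>p \<le> r\<close> by (intro mixed_strategies_convex) auto
  from response[OF this] have Lr_le: "L r \<le> V \<rho> i"
    by (simp add: L_def inner_add_left)
  \<comment> \<open>Affine interpolation at \<open>p\<close> between \<open>q\<close> and
    \<open>r\<close>, multiplied out to avoid dividing by \<open>r - q\<close>.\<close>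
  have chord: "(r - q) * L p = (r - p) * L q + (p - q) * L r"
    by (simp add: L algebra_simps)
  have h\<sigma>: "?h \<bullet> \<sigma> = L p"
    by (simp add: L_def \<sigma>)
  have "L p \<le> V \<rho> i"
  proof (cases "q = r")
    case True
    then have "p = q"
      using \<open>q \<le> p\<close> \<open>p \<le> r\<close> by simp
    then show ?thesis
      using Lq_le by simp
  next
    case False
    then have "r - q > 0"
      using \<open>q \<le> p\<close> \<open>p \<le> r\<close> by simp
    moreover have "(r - q) * L p \<le> (r - p) * V \<rho> i + (p - q) * V \<rho> i"
      unfolding chord using \<open>q \<le> p\<close> \<open>p \<le> r\<close> Lq_le Lr_le by (intro add_mono mult_left_mono) auto
    then have "(r - q) * L p \<le> (r - q) * V \<rho> i"
      by (simp add: algebra_simps)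
    ultimately show ?thesis
      by simp
  qed
  then show "?h \<bullet> \<sigma> \<le> V \<rho> i"
    by (simp add: h\<sigma>)
  assume eq: "?h \<bullet> \<sigma> = V \<rho> i"
  show "V ?C i = V \<rho> i \<or> (\<forall>\<tau>\<in>mixed_strategies. f \<bullet> \<tau> \<le> f \<bullet> \<sigma>)"
  proof (cases "p = r")
    \<comment> \<open>The opponent already plays the maximal strategy, so equality turns
      \<open>response\<close> into optimality of \<open>\<sigma>\<close> for
      \<open>f\<close>.\<close>
    case True
    then have "f \<bullet> \<tau> + g \<bullet> \<sigma> \<le> ?h \<bullet> \<sigma>" if "\<tau> \<in> mixed_strategies" for \<tau>
      using response[OF that] eq \<sigma> by simp
    then show ?thesis
      by (simp add: inner_add_left)
  next
    \<comment> \<open>Now the endpoint \<open>q\<close> has positive weight \<open>r - p\<close> in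
      \<open>chord\<close>, so the bound there is attained.\<close>
    case False
    have "(p - q) * L r \<le> (p - q) * V \<rho> i"
      using Lr_le \<open>q \<le> p\<close> by (intro mult_left_mono) auto
    then have "(r - p) * V \<rho> i \<le> (r - p) * L q"
      using chord eq h\<sigma> by (simp add: algebra_simps)
    then have "V \<rho> i \<le> L q"
      using False \<open>p \<le> r\<close> by simp
    then show ?thesis
      using Lq Lq_le by simp
  qed
qed

text \<open>By \<open>payoff_eq\<close> both sides have the same sum over the two players, so
  neither inequality can be strict.\<close>

lemma nash_opponent_strategy_eq:
  assumes \<rho>: "nash \<rho>"
  shows "(f + g) \<bullet> played D \<rho> (other i) = V \<rho> i"
proof -
  have "policies \<rho>"
    using \<rho> by (simp add: nash_iff)
  then show ?thesis
    using nash_opponent_strategy(1)[OF \<rho>, of i] nash_opponent_strategy(1)[OF \<rho>, of "other i"]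
      payoff_eq[of \<rho> i] payoff_eq[of \<rho> "other i"] by (simp add: inner_add_left)
qed

section \<open>Symmetric equilibria\<close>

lemma payoff_copies:
  assumes "\<pi> \<in> threshold_policies"
  shows "V (\<lambda>_. \<pi>) i = V (\<lambda>_. \<pi>) j"
  using payoff_eq[of "\<lambda>_. \<pi>"] assms played_copies[OF assms] by metis

text \<open>Exchanging the players maps deviations of one to deviations of the other, so checking a
  single player suffices.\<close>

lemma nash_copiesI:
  assumes \<pi>: "\<pi> \<in> threshold_policies"
    and dev: "\<And>x. x \<in> threshold_policies \<Longrightarrow> V (against i x \<pi>) i \<le> V (\<lambda>_. \<pi>) i"
  shows "nash (\<lambda>_. \<pi>)"
proof -
  have *: "V ((\<lambda>_. \<pi>)(k := x)) k \<le> V (\<lambda>_. \<pi>) k" if x: "x \<in> threshold_policies" for k x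
  proof -
    have i: "V ((\<lambda>_. \<pi>)(i := x)) i \<le> V (\<lambda>_. \<pi>) i"
      using dev[OF x] against_other[of i x "\<lambda>_. \<pi>"] by simp
    moreover have "(\<lambda>j. ((\<lambda>_. \<pi>)(i := x)) (other j)) = (\<lambda>_. \<pi>)(other i := x)"
      by (auto simp: fun_eq_iff)
    then have "V ((\<lambda>_. \<pi>)(other i := x)) (other i) = V ((\<lambda>_. \<pi>)(i := x)) i"
      using payoff_swap[of "(\<lambda>_. \<pi>)(i := x)" "other i"] x \<pi> by simp
    ultimately show ?thesis
      using payoff_copies[OF \<pi>] all_player_iff[of "\<lambda>k. V ((\<lambda>_. \<pi>)(k := x)) k \<le> V (\<lambda>_. \<pi>) k" i]
      by metis
  qed
  then show ?thesis
    using \<pi> by (simp add: nash_iff)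
qed

text \<open>Against the opponent's policy, player \<open>i\<close> has the same deviations as in
  \<open>\<rho>\<close>, already bounded by \<open>V \<rho> i\<close>. Against a constant policy a
  deviation affects only the deviator's \<open>f\<close> term, which \<open>?\<sigma>\<close>
  maximizes.\<close>

lemma ex_symmetric_nash:
  assumes \<rho>: "nash \<rho>"
  obtains \<pi> where "nash (\<lambda>_. \<pi>)" "\<And>j. V (\<lambda>_. \<pi>) j = V \<rho> i"
proof -
  let ?\<sigma> = "played D \<rho> (other i)"
  have pol: "policies \<rho>"
    using \<rho> by (simp add: nash_iff)
  from nash_opponent_strategy(2)[OF \<rho> nash_opponent_strategy_eq[OF \<rho>]] show thesis
  proof
    assume eq: "V (\<lambda>_. \<rho> (other i)) i = V \<rho> i"
    have "nash (\<lambda>_. \<rho> (other i))"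
    proof (rule nash_copiesI)
      show "V (against i x (\<rho> (other i))) i \<le> V (\<lambda>_. \<rho> (other i)) i"
        if "x \<in> threshold_policies" for x
        using \<rho> that by (simp add: eq against_other nash_iff)
    qed (use pol in blast)
    then show thesis
      using that payoff_copies eq pol by metis
  next
    assume max: "\<forall>\<tau>\<in>mixed_strategies. f \<bullet> \<tau> \<le> f \<bullet> ?\<sigma>"
    let ?c = "\<lambda>_ :: real. ?\<sigma>"
    have c: "?c \<in> threshold_policies"
      by (intro constant_policy played_mixed pol)
    have played_c: "played D \<rho>' j = ?\<sigma>" if "policies \<rho>'" "\<rho>' j = ?c" for \<rho>' j
    proof -
      interpret prob_space "D \<rho>'"
        by (rule diff_prob_space[OF that(1)])
      show ?thesis
        unfolding played_def[of D \<rho>'] that(2) by (simp add: prob_space)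
    qed
    have Vc: "V (\<lambda>_. ?c) j = V \<rho> i" for j
      using payoff_eq[of "\<lambda>_. ?c" j] played_c[of "\<lambda>_. ?c"] c nash_opponent_strategy_eq[OF \<rho>, of i]
      by (simp add: inner_add_left)
    have "nash (\<lambda>_. ?c)"
    proof (rule nash_copiesI[OF c])
      fix x :: "'a policy"
      assume x: "x \<in> threshold_policies"
      have pol': "policies (against i x ?c)"
        using x c by (simp add: against_def)
      have "against i x ?c (other i) = ?c"
        by (cases i) (simp_all add: against_def)
      then show "V (against i x ?c) i \<le> V (\<lambda>_. ?c) i"
        using max played_mixed[OF pol'] nash_opponent_strategy_eq[OF \<rho>, of i]
        by (simp add: payoff_eq[OF pol'] played_c[OF pol'] Vc inner_add_left
            flip: nash_opponent_strategy_eq[OF \<rho>])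
    qed
    then show thesis
      using that Vc by blast
  qed
qed

end

section \<open>Pareto comparison of equilibria\<close>

theorem theorem4:
  fixes u :: "'a::finite base_game" and D :: "'a diff"
  assumes "symmetric_game u"
    and "additively_decomposable u"
    and "policy_difference D"
    and "symmetric_diff D"
    and "high_value_uninformative D"
    and "minimized_by_copies D"
  shows "let M = diff_meta_game u D in
         (\<forall>\<pi>. nash_equilibrium M \<pi> \<and>
               \<not> (\<exists>\<rho>. nash_equilibrium M \<rho> \<and> pareto_dominates M \<rho> \<pi>)
             \<longrightarrow> payoff M \<pi> P1 = payoff M \<pi> P2)
       \<and> (\<forall>\<pi>. nash_equilibrium M \<pi> \<and> pareto_optimal M \<pi>
             \<longrightarrow> (\<forall>\<rho>. nash_equilibrium M \<rho> \<and> pareto_optimal M \<rho> \<longrightarrow> payoff M \<rho> = payoff M \<pi>)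
               \<and> (\<forall>\<rho>. nash_equilibrium M \<rho> \<longrightarrow>
                      payoff M \<rho> = payoff M \<pi> \<or> pareto_dominates M \<pi> \<rho>)
               \<and> payoff M \<pi> P1 = payoff M \<pi> P2)"
proof -
  obtain w where w: "\<And>i a1 a2. u (pair a1 a2) i = w i P1 a1 + w i P2 a2"
    using assms(2) unfolding additively_decomposable_def by blast
  \<comment> \<open>Both vectors come from the decomposition for \<open>P1\<close>; symmetry
    transfers it to \<open>P2\<close>.\<close>
  interpret symmetric_meta_game u D "\<chi> a. w P1 P1 a" "\<chi> a. w P1 P2 a"
  proof
    show "u (pair a1 a2) i = (\<chi> a. w P1 P1 a) $ pair a1 a2 i + (\<chi> a. w P1 P2 a) $ pair a1 a2 (other i)"
      for a1 a2 i
    proof (cases i)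
      case P1
      then show ?thesis
        by (simp add: w pair_component)
    next
      case P2
      have "u (pair a1 a2) P2 = u (pair a2 a1) P1"
        using assms(1) unfolding symmetric_game_def by (metis other.simps(2))
      then show ?thesis
        using P2 by (simp add: w[of _ _ P1] pair_component)
    qed
  qed (use assms in auto)
  let ?M = "diff_meta_game u D"
  \<comment> \<open>The dominating profile is the symmetric equilibrium that pays
    \<open>V \<rho> i\<close> to both players.\<close>
  have dominated: "\<exists>\<rho>. nash \<rho> \<and> pareto_dominates ?M \<rho> \<pi>" if "nash \<rho>" "\<And>j. V \<pi> j \<le> V \<rho> i"
    "V \<pi> k < V \<rho> i" for \<pi> \<rho> i k
    using ex_symmetric_nash[OF that(1), of i] that(2,3) unfolding pareto_dominates_def by metis
  have equal: "V \<pi> P1 = V \<pi> P2" if "nash \<pi>" "\<not> (\<exists>\<rho>. nash \<rho> \<and> pareto_dominates ?M \<rho> \<pi>)" for \<pi>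
  proof -
    \<comment> \<open>Otherwise the symmetric equilibrium paying both players the larger payoff
      would dominate \<open>\<pi>\<close>.\<close>
    have "\<not> V \<pi> (other i) < V \<pi> i" for i
      using dominated[OF that(1), of \<pi> i "other i"] that(2)
        all_player_iff[of "\<lambda>j. V \<pi> j \<le> V \<pi> i" i] by fastforce
    from this[of P1] this[of P2] show ?thesis
      by simp
  qed
  have undominated: "\<not> (\<exists>\<rho>. nash \<rho> \<and> pareto_dominates ?M \<rho> \<pi>)" if "pareto_optimal ?M \<pi>" for \<pi>
    using that unfolding pareto_optimal_def nash_equilibrium_def by blast
  have dominant: "V \<rho> = V \<pi> \<or> pareto_dominates ?M \<pi> \<rho>"
    if \<pi>: "nash \<pi>" "pareto_optimal ?M \<pi>" and \<rho>: "nash \<rho>" for \<pi> \<rho>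
  proof -
    have const: "V \<pi> j = V \<pi> P1" for j
      using equal[OF \<pi>(1) undominated[OF \<pi>(2)]] by (cases j) auto
    \<comment> \<open>If \<open>\<rho>\<close> paid some player more than the common payoff of
      \<open>\<pi>\<close>, a symmetric equilibrium paying that amount to both would dominate
      \<open>\<pi>\<close>.\<close>
    have "V \<rho> j \<le> V \<pi> j" for j
      using dominated[OF \<rho>, of \<pi> j] undominated[OF \<pi>(2)] const by (metis linorder_not_less order.refl less_imp_le)
    then show ?thesis
      unfolding pareto_dominates_def by (metis ext order.antisym linorder_not_less)
  qed
  show ?thesis
    unfolding Let_def using equal undominated dominant by blast
qed

end
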